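(* (i) Let $G$ be a connected graph on $n$ vertices with Randić matrix $R$. Then $$RE(G)\leq \sqrt{(n-1-\operatorname{null}(R))\,\frac{15n-13}{28}}+1.$$ (ii) Let $G$ be a connected bipartite graph on $n$ vertices with Randić matrix $R$. Then $$RE(G)\leq \sqrt{(n-2-\operatorname{null}(R))\,\frac{15n-41}{28}}+2.$$ (iii) Let $T$ be a tree on $n$ vertices with Randić matrix $R$. Then $$RE(T)\leq \sqrt{(n-2-\operatorname{null}(R))\,\frac{5n-10}{9}}+2.$$ (iv) Let $T$ be a tree of order $n\geq 103$ with Randić matrix $R$. Then $$RE(T)\leq \sqrt{(n-2-\operatorname{null}(R))\,\frac{15n-57}{28}}+2.$$
   Context: Graphs are finite, simple and undirected. For a graph $G$ with vertex set $V$, edge set $E$ and vertex degrees $d_u$, the Randić matrix $R=[r_{uv}]$ is the real symmetric matrix indexed by $V$ with $r_{uv}=1/\sqrt{d_ud_v}$ if $uv\in E$ and $r_{uv}=0$ otherwise. The Randić energy is $RE(G)=\sum_{i=1}^n|\lambda_i|$, where $\lambda_1,\dots,\lambda_n$ are the eigenvalues of $R$ with multiplicity. $\operatorname{null}(R)$ denotes the dimension of the null space of $R$.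
   Formalization: Part (i) is stated for n ≥ 3 only: for n = 2 the graph K_2 has RE = 2 > sqrt(17/28) + 1, so the printed bound fails, and for n = 1 the quantity under the root is negative. *)

theory Defs
  imports
    "HOL-Analysis.Analysis"
    "HOL-Computational_Algebra.Polynomial"
begin

text \<open>
  A graph has the finite (hence nonempty) type \<open>'v\<close> as its vertex set, so its order is
  \<open>CARD('v)\<close>, and is given by its adjacency relation.
\<close>

definition simple_graph :: "('v \<Rightarrow> 'v \<Rightarrow> bool) \<Rightarrow> bool" where
  "simple_graph E \<longleftrightarrow> symp E \<and> irreflp E"

definition vertex_degree :: "('v \<Rightarrow> 'v \<Rightarrow> bool) \<Rightarrow> 'v \<Rightarrow> nat" where
  "vertex_degree E u = card {v. E u v}"

definition connected_graph :: "('v \<Rightarrow> 'v \<Rightarrow> bool) \<Rightarrow> bool" where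
  "connected_graph E \<longleftrightarrow> (\<forall>u v. E\<^sup>*\<^sup>* u v)"

definition bipartite_graph :: "('v \<Rightarrow> 'v \<Rightarrow> bool) \<Rightarrow> bool" where
  "bipartite_graph E \<longleftrightarrow> (\<exists>A B. A \<union> B = UNIV \<and> A \<inter> B = {} \<and>
     (\<forall>u v. E u v \<longrightarrow> (u \<in> A \<and> v \<in> B) \<or> (u \<in> B \<and> v \<in> A)))"

text \<open>The closing edge of a cycle joins the last to the first entry of the list.\<close>

definition is_cycle :: "('v \<Rightarrow> 'v \<Rightarrow> bool) \<Rightarrow> 'v list \<Rightarrow> bool" where
  "is_cycle E c \<longleftrightarrow> length c \<ge> 3 \<and> distinct c \<and> successively E c \<and> E (last c) (hd c)"

definition tree_graph :: "('v \<Rightarrow> 'v \<Rightarrow> bool) \<Rightarrow> bool" where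
  "tree_graph E \<longleftrightarrow> connected_graph E \<and> (\<nexists>c. is_cycle E c)"

definition randic_matrix :: "('v::finite \<Rightarrow> 'v \<Rightarrow> bool) \<Rightarrow> real^'v^'v" where
  "randic_matrix E =
     (\<chi> u v. if E u v then 1 / sqrt (real (vertex_degree E u) * real (vertex_degree E v)) else 0)"

text \<open>The determinant of \<open>x I - A\<close>, taken over the polynomial ring.\<close>

definition charpoly :: "real^'n^'n \<Rightarrow> real poly" where
  "charpoly A = det (mat [:0, 1:] - (\<chi> i j. [:A $ i $ j:]))"

text \<open>
  The real eigenvalues with their algebraic multiplicities.  For a symmetric matrix, such as the
  \<open>randic_matrix\<close> of a simple graph, there are no others.
\<close>

definition eigenvalues :: "real^'n^'n \<Rightarrow> real multiset" where
  "eigenvalues A = proots (charpoly A)"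

definition randic_energy :: "('v::finite \<Rightarrow> 'v \<Rightarrow> bool) \<Rightarrow> real" where
  "randic_energy E = (\<Sum>x\<in>#eigenvalues (randic_matrix E). \<bar>x\<bar>)"

definition nullity :: "real^'n^'n \<Rightarrow> nat" where
  "nullity A = dim {x. A *v x = 0}"

end

theory Submission
  imports Defs
begin

text \<open>
  Write \<open>S\<close> for the sum of the squared entries of \<open>R\<close>. It is the sum of the squared eigenvalues, and it
  equals \<open>2 \<rho>\<close>, where \<open>\<rho> = \<Sum>\<^sub>u\<^sub>v 1 / (d\<^sub>u d\<^sub>v)\<close>, summed over the edges, is the general Randic index of
  exponent \<open>-1\<close>. The vector \<open>(sqrt d\<^sub>u)\<^sub>u\<close> is an eigenvector of \<open>R\<close> for the eigenvalue \<open>1\<close>; if the graph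
  is bipartite, changing the signs on one side gives one for \<open>-1\<close>. Setting these one or two eigenvalues
  aside, the at most \<open>n - 1 - null R\<close> (respectively \<open>n - 2 - null R\<close>) remaining nonzero ones have
  squares summing to \<open>S - 1\<close> (respectively \<open>S - 2\<close>), and the Cauchy--Schwarz inequality bounds the sum
  of their absolute values (\<open>energy_bound_unit_eigenvalues\<close>). What is left is to bound \<open>\<rho>\<close>:
  by \<open>(15 n + 13) / 56\<close> for every connected graph with at least three vertices
  (\<open>randic_index_connected\<close>), and by \<open>(15 n - 1) / 56\<close> once \<open>n \<ge> 103\<close>
  (\<open>randic_index_connected_large\<close>). The first bound gives (i), and for \<open>n \<ge> 3\<close> also (ii) and
  (iii), whose cases \<open>n \<le> 2\<close> are immediate; the second gives (iv). A tree enters as a connected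
  bipartite graph.

  Both bounds come from one discharging argument (\<open>randic_index_discharging\<close>). Fix a root and a
  breadth-first spanning tree. Call the part of the tree at and below a vertex its branch. A branch of
  \<open>m\<close> vertices is worth the weight of its tree edges, and of the halves of other edges described below,
  minus \<open>15 m / 56\<close>. If its top has degree \<open>c\<close>, this worth is at most a constant \<open>F c\<close>: a top of
  degree \<open>d\<close> has \<open>d - 1\<close> slots below it, and a branch of top degree \<open>c\<close> in such a slot contributes at
  most \<open>F c + 1 / (c d)\<close>. An edge outside the spanning tree is split into halves that occupy one slot at
  each end, and such a half is dominated by what a branch of top degree four can contribute, because
  \<open>F 4 = 0\<close>. The best branches are small: a leaf, a leaf hanging from a vertex of degree two, and
  vertices of degree three or four carrying two, respectively three, such pendant paths.

  A root of degree \<open>k\<close> adds at most \<open>k\<close> times the best slot value minus \<open>15/56\<close>. For \<open>k \<ge> 2\<close> this is at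
  most \<open>13/56\<close>, and for \<open>k \<ge> 14\<close> it is at most \<open>-1/56\<close>. If all degrees are at most thirteen, root at a
  vertex of maximum degree and charge slightly less than \<open>15/56\<close> per vertex: bounded degrees leave
  enough slack in the recursion for \<open>F\<close>, and the amount saved on \<open>103\<close> vertices pays for the root.
\<close>

section \<open>Diagonalization of symmetric matrices\<close>

text \<open>
  A maximiser \<open>x\<close> of the quadratic form \<open>x \<bullet> f x\<close> on the unit sphere of \<open>S\<close>, with maximum \<open>c\<close>, is an
  eigenvector: perturbing it in the direction \<open>y = f x - c x\<close> changes \<open>x \<bullet> f x - c (x \<bullet> x)\<close> to first order
  by \<open>2 t (y \<bullet> y)\<close>, which must not become positive.
\<close>
lemma self_adjoint_eigenvector:
  fixes f :: "'a::euclidean_space \<Rightarrow> 'a"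
  assumes f: "linear f" and adj: "\<And>x y. f x \<bullet> y = x \<bullet> f y"
    and S: "subspace S" "f ` S \<subseteq> S" "S \<noteq> {0}"
  obtains x c where "x \<in> S" "norm x = 1" "f x = c *\<^sub>R x"
proof -
  define q where "q x = x \<bullet> f x" for x
  have cont: "continuous_on A q" for A
    unfolding q_def
    by (intro continuous_intros linear_continuous_on linear_conv_bounded_linear[THEN iffD1] f)
  have "compact (S \<inter> sphere 0 1)"
    using S(1) by (simp add: closed_subspace closed_Int_compact)
  moreover have "S \<inter> sphere 0 1 \<noteq> {}"
  proof -
    obtain z where z: "z \<in> S" "z \<noteq> 0"
      using S(1,3) subspace_0 by blast
    then have "(1 / norm z) *\<^sub>R z \<in> S \<inter> sphere 0 1"
      using S(1) by (simp add: subspace_scale)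
    then show ?thesis by blast
  qed
  ultimately obtain x where x: "x \<in> S" "norm x = 1"
      and max: "\<And>y. y \<in> S \<Longrightarrow> norm y = 1 \<Longrightarrow> q y \<le> q x"
    using continuous_attains_sup[OF _ _ cont] by force
  define c where "c = q x"
  have le: "q y \<le> c * (y \<bullet> y)" if "y \<in> S" for y
  proof (cases "y = 0")
    case False
    have "q ((1 / norm y) *\<^sub>R y) \<le> c"
      unfolding c_def using False S(1) that by (intro max) (auto simp: subspace_scale)
    moreover have "q ((1 / norm y) *\<^sub>R y) = q y / (y \<bullet> y)"
      by (simp add: q_def linear_scale[OF f] dot_square_norm power2_eq_square)
    ultimately show ?thesis
      using False by (simp add: divide_le_eq)
  qed (simp add: q_def)
  define y where "y = f x - c *\<^sub>R x"
  have y: "y \<in> S"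
    unfolding y_def using S x by (intro subspace_diff subspace_scale) auto
  define K where "K = c * (y \<bullet> y) - q y"
  have K: "K \<ge> 0" using le[OF y] by (simp add: K_def)
  have perturb: "2 * t * (y \<bullet> y) \<le> t\<^sup>2 * K" for t
  proof -
    have "x + t *\<^sub>R y \<in> S"
      using S x y by (intro subspace_add subspace_scale) auto
    then have "q (x + t *\<^sub>R y) \<le> c * ((x + t *\<^sub>R y) \<bullet> (x + t *\<^sub>R y))"
      by (rule le)
    also have "(x + t *\<^sub>R y) \<bullet> (x + t *\<^sub>R y) = 1 + 2 * t * (x \<bullet> y) + t\<^sup>2 * (y \<bullet> y)"
      using x by (simp add: inner_simps inner_commute power2_eq_square algebra_simps norm_eq_1)
    also have "q (x + t *\<^sub>R y) = c + 2 * t * (f x \<bullet> y) + t\<^sup>2 * q y"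
      using adj[of x y] adj[of y x]
      by (simp add: q_def c_def linear_add[OF f] linear_scale[OF f] inner_simps
          inner_commute power2_eq_square algebra_simps)
    also have "f x \<bullet> y = y \<bullet> y + c * (x \<bullet> y)"
      using inner_diff_left[of "f x" "c *\<^sub>R x" y] by (simp flip: y_def)
    finally show ?thesis
      by (simp add: K_def algebra_simps)
  qed
  have "y \<bullet> y = 0"
  proof (rule ccontr)
    assume "y \<bullet> y \<noteq> 0"
    then have N: "y \<bullet> y > 0" by simp
    \<comment> \<open>\<open>K + 1\<close> rather than \<open>K\<close>, since \<open>K\<close> may vanish; the second-order term is then at most \<open>t (y \<bullet> y)\<close>.\<close>
    define t where "t = (y \<bullet> y) / (K + 1)"
    have t: "t > 0" using N K by (simp add: t_def)
    have "t * K \<le> y \<bullet> y"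
      using N K by (simp add: t_def field_simps)
    moreover have "2 * (y \<bullet> y) \<le> t * K"
      using perturb[of t] t by (simp add: power2_eq_square)
    ultimately show False using N by linarith
  qed
  then have "f x = c *\<^sub>R x" by (simp add: y_def)
  with x show thesis by (rule that)
qed

text \<open>
  Split off one eigenvector; self-adjointness makes its orthogonal complement within \<open>S\<close> invariant again.
\<close>
lemma self_adjoint_eigenbasis:
  fixes f :: "'a::euclidean_space \<Rightarrow> 'a"
  assumes f: "linear f" and adj: "\<And>x y. f x \<bullet> y = x \<bullet> f y"
    and S: "subspace S" "f ` S \<subseteq> S"
  shows "\<exists>B \<subseteq> S. pairwise orthogonal B \<and> span B = S \<and>
           (\<forall>b\<in>B. norm b = 1 \<and> (\<exists>c. f b = c *\<^sub>R b))"
  using S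
proof (induction "dim S" arbitrary: S rule: less_induct)
  case less
  show ?case
  proof (cases "S = {0}")
    case True
    then show ?thesis by (intro exI[of _ "{}"]) auto
  next
    case False
    obtain x c where x: "x \<in> S" "norm x = 1" "f x = c *\<^sub>R x"
      using self_adjoint_eigenvector[OF f adj less.prems False] by blast
    define T where "T = S \<inter> {y. x \<bullet> y = 0}"
    have T: "subspace T"
      unfolding T_def using less.prems(1) subspace_hyperplane[of x] by (simp add: subspace_inter)
    have xT: "x \<notin> T" using x by (auto simp: T_def norm_eq_1)
    have "T \<subset> S" using x(1) xT unfolding T_def by blast
    then have "dim T < dim S"
      by (metis T less.prems(1) dim_psubset span_eq_iff)
    moreover have "f ` T \<subseteq> T"
      using less.prems(2) x(3) adj[of x, symmetric] by (auto simp: T_def)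
    ultimately obtain B where B: "B \<subseteq> T" "pairwise orthogonal B" "span B = T"
        "\<And>b. b \<in> B \<Longrightarrow> norm b = 1 \<and> (\<exists>c. f b = c *\<^sub>R b)"
      using less.hyps[OF _ T] by meson
    have "pairwise orthogonal (insert x B)"
      using B(1,2) by (auto simp: pairwise_insert orthogonal_def T_def inner_commute)
    moreover have "span (insert x B) = S"
    proof
      show "span (insert x B) \<subseteq> S"
        using B(1) x(1) less.prems(1) by (intro span_minimal) (auto simp: T_def)
      show "S \<subseteq> span (insert x B)"
      proof
        fix y assume y: "y \<in> S"
        have "y - (x \<bullet> y) *\<^sub>R x \<in> T"
          using x y less.prems(1)
          by (auto simp: T_def inner_simps norm_eq_1 intro!: subspace_diff subspace_scale)
        then have "y - (x \<bullet> y) *\<^sub>R x \<in> span B" using B(3) by simp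
        then show "y \<in> span (insert x B)"
          by (auto simp: span_insert)
      qed
    qed
    ultimately show ?thesis
      using B(1,4) x by (intro exI[of _ "insert x B"]) (auto simp: T_def)
  qed
qed

theorem symmetric_matrix_diagonalizable:
  fixes A :: "real^'n^'n"
  assumes sym: "transpose A = A"
  obtains P l where "orthogonal_matrix P" "\<And>i. A *v (P $ i) = l i *\<^sub>R (P $ i)"
proof -
  have adj: "(A *v x) \<bullet> y = x \<bullet> (A *v y)" for x y
    using sym by (metis dot_lmul_matrix vector_transpose_matrix)
  obtain B :: "(real^'n) set" where B: "pairwise orthogonal B" "span B = UNIV"
      "\<And>b. b \<in> B \<Longrightarrow> norm b = 1" "\<And>b. b \<in> B \<Longrightarrow> \<exists>c. A *v b = c *\<^sub>R b"
    using self_adjoint_eigenbasis[OF matrix_vector_mul_linear adj subspace_UNIV] by auto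
  have "independent B"
    using B(1,3) by (intro pairwise_orthogonal_independent) fastforce+
  then have "card B = CARD('n)" and fin: "finite B"
    using B(2) dim_eq_card_independent dim_span dim_UNIV finiteI_independent
    by (metis DIM_cart DIM_real mult_1_right, blast intro: finiteI_independent)
  then obtain b where b: "bij_betw b (UNIV :: 'n set) B"
    using finite_same_card_bij[of "UNIV :: 'n set" B] by auto
  obtain c where c: "\<And>v. v \<in> B \<Longrightarrow> A *v v = c v *\<^sub>R v"
    using B(4) by metis
  have bB: "b i \<in> B" for i using b by (auto simp: bij_betw_def)
  have "b i \<bullet> b j = (if i = j then 1 else 0)" for i j
  proof (cases "i = j")
    case False
    then have "b i \<noteq> b j" using b by (auto simp: bij_betw_def inj_def)
    with False show ?thesis
      using B(1) bB by (auto simp: pairwise_def orthogonal_def)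
  qed (use B(3) bB in \<open>auto simp: norm_eq_1\<close>)
  then have "(\<chi> i. b i) ** transpose (\<chi> i. b i) = mat 1"
    by (simp add: matrix_matrix_mult_def transpose_def mat_def vec_eq_iff inner_vec_def)
  then have "orthogonal_matrix (\<chi> i. b i)"
    by (simp add: orthogonal_matrix_def matrix_left_right_inverse)
  then show thesis
    by (rule that[of _ "\<lambda>i. c (b i)"]) (simp add: c bB)
qed

text \<open>
  With the eigenvectors as columns of \<open>Q\<close>, the equation \<open>(x I - A) Q = Q (x I - D)\<close> for the diagonal matrix
  \<open>D\<close> of eigenvalues holds over the polynomial ring, where \<open>det Q\<close> can be cancelled.
\<close>
lemma charpoly_eq_prod_eigenvalues:
  fixes A :: "real^'n^'n"
  assumes P: "orthogonal_matrix P" and ev: "\<And>i. A *v (P $ i) = l i *\<^sub>R (P $ i)"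
  shows "charpoly A = (\<Prod>i\<in>UNIV. [:- l i, 1:])"
proof -
  have const_sum: "(\<Sum>k\<in>S. [:g k:]) = [:\<Sum>k\<in>S. g k:]" for g :: "'n \<Rightarrow> real" and S
    by (induction S rule: infinite_finite_induct) auto
  define Q :: "real poly^'n^'n" where "Q = (\<chi> i j. [:P $ j $ i:])"
  define D :: "real poly^'n^'n" where "D = (\<chi> i j. if i = j then [:- l i, 1:] else 0)"
  have APev: "(\<Sum>k\<in>UNIV. A $ i $ k * P $ j $ k) = l j * P $ j $ i" for i j
    using arg_cong[OF ev[of j], of "\<lambda>v. v $ i"] by (simp add: matrix_vector_mult_def)
  have "(mat [:0, 1:] - (\<chi> i j. [:A $ i $ j:])) ** Q = Q ** D"
  proof -
    have "((mat [:0, 1:] - (\<chi> i j. [:A $ i $ j:])) ** Q) $ i $ j = (Q ** D) $ i $ j" for i j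
    proof -
      have "((mat [:0, 1:] - (\<chi> i j. [:A $ i $ j:])) ** Q) $ i $ j
          = (\<Sum>k\<in>UNIV. (if i = k then [:0, 1:] * [:P $ j $ k:] else 0) - [:A $ i $ k * P $ j $ k:])"
        unfolding matrix_matrix_mult_def
        by (auto simp: mat_def Q_def left_diff_distrib intro!: sum.cong)
      also have "\<dots> = [:0, 1:] * [:P $ j $ i:] - [:l j * P $ j $ i:]"
        by (simp only: sum_subtractf const_sum APev sum.delta' sum.delta finite UNIV_I if_True)
      also have "\<dots> = (\<Sum>k\<in>UNIV. [:P $ k $ i:] * (if k = j then [:- l k, 1:] else 0))"
        by (simp add: if_distrib[of "\<lambda>q. _ * q"] mult.commute cong: if_cong)
      also have "\<dots> = (Q ** D) $ i $ j"
        by (simp add: matrix_matrix_mult_def D_def Q_def)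
      finally show ?thesis .
    qed
    then show ?thesis by (simp add: vec_eq_iff)
  qed
  then have "charpoly A * det Q = det Q * det D"
    unfolding charpoly_def by (metis det_mul)
  moreover have "det Q \<noteq> 0"
  proof -
    have "transpose P ** P = mat 1"
      using P by (simp add: orthogonal_matrix_def)
    then have orth: "(\<Sum>k\<in>UNIV. P $ k $ i * P $ k $ j) = (if i = j then 1 else 0)" for i j
      by (auto simp: vec_eq_iff matrix_matrix_mult_def transpose_def mat_def)
    have "Q ** transpose Q = mat 1"
      by (auto simp: vec_eq_iff matrix_matrix_mult_def transpose_def mat_def Q_def const_sum orth)
    then have "det Q * det (transpose Q) = 1"
      by (metis det_I det_mul)
    then show ?thesis by auto
  qed
  moreover have "det D = (\<Prod>i\<in>UNIV. [:- l i, 1:])"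
    by (subst det_diagonal) (auto simp: D_def)
  ultimately show ?thesis by simp
qed

lemma eigenvalues_of_eigenbasis:
  fixes A :: "real^'n^'n"
  assumes "orthogonal_matrix P" and "\<And>i. A *v (P $ i) = l i *\<^sub>R (P $ i)"
  shows "eigenvalues A = image_mset l (mset_set UNIV)"
proof -
  have "eigenvalues A = (\<Sum>i\<in>UNIV. {#l i#})"
    unfolding eigenvalues_def charpoly_eq_prod_eigenvalues[OF assms] by (subst proots_prod) auto
  also have "\<dots> = image_mset l (mset_set UNIV)"
    by (simp add: sum_unfold_sum_mset)
  finally show ?thesis .
qed

lemma self_adjoint_component:
  fixes A :: "real^'n^'n"
  assumes sym: "transpose A = A" and ev: "A *v p = l *\<^sub>R p"
  shows "p \<bullet> (A *v x) = l * (p \<bullet> x)"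
proof -
  have "p \<bullet> (A *v x) = (p v* A) \<bullet> x"
    by (simp add: dot_lmul_matrix)
  also have "p v* A = A *v p"
    using transpose_matrix_vector[of A p] sym by simp
  finally show ?thesis by (simp add: ev)
qed

lemma orthogonal_matrix_row_expansion:
  fixes P :: "real^'n^'n"
  assumes "orthogonal_matrix P"
  shows "x = (\<Sum>i\<in>UNIV. (P $ i \<bullet> x) *\<^sub>R P $ i)"
proof -
  have "x = transpose P *v (P *v x)"
    using assms by (simp add: orthogonal_matrix_def matrix_vector_mul_assoc)
  also have "\<dots> = (\<Sum>i\<in>UNIV. (P $ i \<bullet> x) *\<^sub>R P $ i)"
    unfolding matrix_mult_sum[of "transpose P"]
    by (simp add: column_transpose row_def matrix_vector_mul_component scalar_mult_eq_scaleR)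
  finally show ?thesis .
qed

lemma eigenvalue_in_eigenbasis:
  fixes A :: "real^'n^'n"
  assumes sym: "transpose A = A" and P: "orthogonal_matrix P"
    and ev: "\<And>i. A *v (P $ i) = l i *\<^sub>R (P $ i)" and x: "A *v x = c *\<^sub>R x" "x \<noteq> 0"
  shows "\<exists>i. l i = c"
proof (rule ccontr)
  assume "\<nexists>i. l i = c"
  then have "P $ i \<bullet> x = 0" for i
    using self_adjoint_component[OF sym ev, of i x] x(1) by auto
  then show False
    using orthogonal_matrix_row_expansion[OF P, of x] x(2) by simp
qed

text \<open>
  A null vector is orthogonal to the eigenvectors of nonzero eigenvalues, so it lies in the span of the
  others.
\<close>
lemma nullity_le_zero_eigenvalues:
  fixes A :: "real^'n^'n"
  assumes sym: "transpose A = A" and P: "orthogonal_matrix P"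
    and ev: "\<And>i. A *v (P $ i) = l i *\<^sub>R (P $ i)"
  shows "nullity A \<le> card {i. l i = 0}"
proof -
  have "x \<in> span (($) P ` {i. l i = 0})" if "A *v x = 0" for x
  proof -
    have zero: "l i \<noteq> 0 \<Longrightarrow> P $ i \<bullet> x = 0" for i
      using self_adjoint_component[OF sym ev, of i x] that by simp
    have "(\<Sum>i\<in>UNIV. (P $ i \<bullet> x) *\<^sub>R P $ i) \<in> span (($) P ` {i. l i = 0})"
    proof (intro span_sum)
      fix i show "(P $ i \<bullet> x) *\<^sub>R P $ i \<in> span (($) P ` {i. l i = 0})"
        by (cases "l i = 0") (auto simp: zero intro: span_scale span_base span_zero)
    qed
    then show ?thesis
      using orthogonal_matrix_row_expansion[OF P, of x] by simp
  qed
  then have "nullity A \<le> card (($) P ` {i. l i = 0})"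
    unfolding nullity_def by (intro dim_le_card) auto
  also have "\<dots> \<le> card {i. l i = 0}"
    by (intro card_image_le) simp
  finally show ?thesis .
qed

text \<open>
  Both sides are the sum of the squared entries of \<open>A P\<^sup>T\<close>: by columns these are images of unit
  eigenvectors, by rows they are rotated rows of \<open>A\<close>.
\<close>
lemma sum_squares_eigenvalues:
  fixes A :: "real^'n^'n"
  assumes sym: "transpose A = A" and P: "orthogonal_matrix P"
    and ev: "\<And>i. A *v (P $ i) = l i *\<^sub>R (P $ i)"
  shows "(\<Sum>i\<in>UNIV. (l i)\<^sup>2) = (\<Sum>i\<in>UNIV. \<Sum>j\<in>UNIV. (A $ i $ j)\<^sup>2)"
proof -
  have row_norm: "P $ i \<bullet> P $ i = 1" for i
    using P by (simp add: orthogonal_matrix_orthonormal_rows row_def norm_eq_1)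
  have norm_P: "(P *v x) \<bullet> (P *v x) = x \<bullet> x" for x
  proof -
    have "(P *v x) \<bullet> (P *v x) = (transpose P *v (P *v x)) \<bullet> x"
      by (simp add: dot_lmul_matrix transpose_matrix_vector)
    then show ?thesis
      using P by (simp add: orthogonal_matrix_def matrix_vector_mul_assoc)
  qed
  have "(\<Sum>i\<in>UNIV. (l i)\<^sup>2) = (\<Sum>i\<in>UNIV. (A *v P $ i) \<bullet> (A *v P $ i))"
    by (simp add: ev row_norm power2_eq_square)
  also have "\<dots> = (\<Sum>i\<in>UNIV. \<Sum>j\<in>UNIV. (A $ j \<bullet> P $ i)\<^sup>2)"
    by (simp add: inner_vec_def[of "A *v _"] matrix_vector_mul_component power2_eq_square)
  also have "\<dots> = (\<Sum>j\<in>UNIV. \<Sum>i\<in>UNIV. (A $ j \<bullet> P $ i)\<^sup>2)"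
    by (rule sum.swap)
  also have "\<dots> = (\<Sum>j\<in>UNIV. (P *v A $ j) \<bullet> (P *v A $ j))"
    by (simp add: inner_vec_def[of "P *v _"] matrix_vector_mul_component power2_eq_square inner_commute)
  also have "\<dots> = (\<Sum>i\<in>UNIV. \<Sum>j\<in>UNIV. (A $ i $ j)\<^sup>2)"
    unfolding norm_P by (simp add: inner_vec_def power2_eq_square)
  finally show ?thesis .
qed

text \<open>
  The Koolen--Moulton device: eigenvalues of known modulus one are set aside before the Cauchy--Schwarz
  inequality is applied, and zero eigenvalues do not enter it. The set \<open>C\<close> lists the eigenvalues set aside,
  each of them once.
\<close>
lemma energy_bound_unit_eigenvalues:
  fixes A :: "real^'n^'n"
  assumes sym: "transpose A = A"
    and C: "C \<subseteq> {1, -1}" "\<And>c. c \<in> C \<Longrightarrow> \<exists>x. x \<noteq> 0 \<and> A *v x = c *\<^sub>R x"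
  shows "card C + nullity A \<le> CARD('n)"
    and "(\<Sum>x\<in>#eigenvalues A. \<bar>x\<bar>)
      \<le> sqrt ((real CARD('n) - card C - nullity A)
              * ((\<Sum>i\<in>UNIV. \<Sum>j\<in>UNIV. (A $ i $ j)\<^sup>2) - card C)) + card C"
proof -
  obtain P l where P: "orthogonal_matrix P" and ev: "\<And>i. A *v (P $ i) = l i *\<^sub>R (P $ i)"
    using symmetric_matrix_diagonalizable[OF sym] by blast
  have "\<forall>c\<in>C. \<exists>i. l i = c"
    using C(2) eigenvalue_in_eigenbasis[OF sym P ev] by blast
  then obtain j where j: "\<And>c. c \<in> C \<Longrightarrow> l (j c) = c" by metis
  define J where "J = j ` C"
  define N where "N = {i. l i \<noteq> 0}"
  have cardJ: "card J = card C"
    unfolding J_def by (intro card_image inj_onI) (metis j)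
  have absJ: "\<bar>l i\<bar> = 1" if "i \<in> J" for i
    using that j C(1) by (auto simp: J_def)
  then have JN: "J \<subseteq> N" by (force simp: N_def)
  have "card N = CARD('n) - card {i. l i = 0}"
    unfolding N_def by (simp add: Collect_neg_eq Compl_eq_Diff_UNIV card_Diff_subset)
  then have cardN: "card N + nullity A \<le> CARD('n)"
    using nullity_le_zero_eigenvalues[OF sym P ev] card_mono[of UNIV "{i. l i = 0}"] by auto
  then show "card C + nullity A \<le> CARD('n)"
    using card_mono[OF _ JN] cardJ by simp
  have "(\<Sum>x\<in>#eigenvalues A. \<bar>x\<bar>) = (\<Sum>i\<in>UNIV. \<bar>l i\<bar>)"
    by (simp add: eigenvalues_of_eigenbasis[OF P ev] sum_unfold_sum_mset image_mset.compositionality comp_def)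
  also have "\<dots> = (\<Sum>i\<in>N. \<bar>l i\<bar>)"
    by (intro sum.mono_neutral_right) (auto simp: N_def)
  also have "\<dots> = (\<Sum>i\<in>N - J. \<bar>l i\<bar>) + card C"
    using JN absJ cardJ by (subst sum.subset_diff[of J]) auto
  also have "(\<Sum>i\<in>N - J. \<bar>l i\<bar>) \<le> sqrt (card (N - J) * (\<Sum>i\<in>N - J. (l i)\<^sup>2))"
    using Cauchy_Schwarz_ineq_sum[of "\<lambda>_. 1" "\<lambda>i. \<bar>l i\<bar>" "N - J"]
    by (intro real_le_rsqrt) simp
  also have "\<dots> \<le> sqrt ((real CARD('n) - card C - nullity A)
                 * ((\<Sum>i\<in>UNIV. \<Sum>j\<in>UNIV. (A $ i $ j)\<^sup>2) - card C))"
  proof -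
    have "(\<Sum>i\<in>N - J. (l i)\<^sup>2) + card C = (\<Sum>i\<in>N - J. (l i)\<^sup>2) + (\<Sum>i\<in>J. (l i)\<^sup>2)"
      using sum.cong[OF refl, of J "\<lambda>i. (l i)\<^sup>2" "\<lambda>_. 1"] absJ cardJ
      by (metis one_power2 power2_abs real_of_card)
    also have "\<dots> = (\<Sum>i\<in>N. (l i)\<^sup>2)"
      using JN by (subst (2) sum.subset_diff[of J]) auto
    also have "\<dots> = (\<Sum>i\<in>UNIV. (l i)\<^sup>2)"
      by (intro sum.mono_neutral_left) (auto simp: N_def)
    finally have "(\<Sum>i\<in>N - J. (l i)\<^sup>2) = (\<Sum>i\<in>UNIV. \<Sum>j\<in>UNIV. (A $ i $ j)\<^sup>2) - card C"
      using sum_squares_eigenvalues[OF sym P ev] by simp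
    moreover have "real (card (N - J)) \<le> real CARD('n) - card C - nullity A"
      using cardN card_mono[OF _ JN] card_Diff_subset[OF _ JN] cardJ by auto
    ultimately show ?thesis
      by (metis mult_right_mono real_sqrt_le_mono sum_nonneg zero_le_power2)
  qed
  finally show "(\<Sum>x\<in>#eigenvalues A. \<bar>x\<bar>)
      \<le> sqrt ((real CARD('n) - card C - nullity A)
              * ((\<Sum>i\<in>UNIV. \<Sum>j\<in>UNIV. (A $ i $ j)\<^sup>2) - card C)) + card C"
    by simp
qed

section \<open>Breadth-first trees and bipartiteness\<close>

text \<open>
  The distance \<open>h\<close> from \<open>r\<close> and a parent \<open>p v\<close> one step closer to \<open>r\<close> for every other vertex \<open>v\<close>.
\<close>
lemma bfs_tree:
  assumes E: "symp E" and conn: "connected_graph E"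
  obtains h :: "'v \<Rightarrow> nat" and p :: "'v \<Rightarrow> 'v"
  where "\<And>v. v \<noteq> r \<Longrightarrow> E v (p v) \<and> h v = Suc (h (p v))"
    and "\<And>u v. E u v \<Longrightarrow> h v \<le> Suc (h u)"
    and "h r = 0"
proof -
  define h where "h v = (LEAST n. (E ^^ n) r v)" for v
  have "\<exists>n. (E ^^ n) r v" for v
    using conn by (simp add: connected_graph_def rtranclp_power)
  then have walk: "(E ^^ h v) r v" for v
    unfolding h_def by (rule LeastI_ex)
  have h_le: "h v \<le> n" if "(E ^^ n) r v" for n v
    unfolding h_def using that by (rule Least_le)
  have step: "h v \<le> Suc (h u)" if "E u v" for u v
    using walk[of u] that by (intro h_le) auto
  have "\<exists>u. E v u \<and> h v = Suc (h u)" if "v \<noteq> r" for v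
  proof -
    have "h v \<noteq> 0"
      using walk[of v] that by (metis relpowp_0_E)
    then obtain m where m: "h v = Suc m"
      using not0_implies_Suc by blast
    then obtain u where u: "(E ^^ m) r u" "E u v"
      using walk[of v] by auto
    then have "h v = Suc (h u)"
      using h_le[OF u(1)] step[OF u(2)] m by simp
    then show ?thesis using sympD[OF E u(2)] by blast
  qed
  then obtain p where "\<And>v. v \<noteq> r \<Longrightarrow> E v (p v) \<and> h v = Suc (h (p v))" by metis
  moreover have "h r = 0"
    using h_le[of 0 r] by simp
  ultimately show thesis using step that by blast
qed

text \<open>
  Colour by the parity of the distance from a root. An edge inside one colour class would join two vertices
  at equal distance; following their parents upwards until they meet closes it to a cycle.
\<close>
lemma tree_is_bipartite:
  assumes E: "simple_graph E" and T: "tree_graph E"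
  shows "bipartite_graph E"
proof -
  have sym: "symp E" and conn: "connected_graph E" and acyclic: "\<nexists>c. is_cycle E c"
    using assms by (auto simp: simple_graph_def tree_graph_def)
  obtain h :: "'a \<Rightarrow> nat" and p where hp: "\<And>v. v \<noteq> undefined \<Longrightarrow> E v (p v) \<and> h v = Suc (h (p v))"
      and step: "\<And>u v. E u v \<Longrightarrow> h v \<le> Suc (h u)" and h0: "h undefined = 0"
    by (rule bfs_tree[OF sym conn, of undefined]) (rule that; assumption)
  \<comment> \<open>The bound on \<open>h\<close> keeps the path within distance \<open>m\<close> of the root, so that vertices at distance
     \<open>m + 1\<close> extend it without repetition.\<close>
  have path: "\<exists>c. length c \<ge> 3 \<and> distinct c \<and> successively E c \<and> hd c = u \<and> last c = v
        \<and> (\<forall>w\<in>set c. h w \<le> m)" if "h u = m" "h v = m" "u \<noteq> v" for u v m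
    using that
  proof (induction m arbitrary: u v)
    case 0
    then show ?case using hp by (metis Zero_not_Suc)
  next
    case (Suc m)
    have ne: "u \<noteq> undefined" "v \<noteq> undefined" using h0 Suc.prems by auto
    then have pu: "E u (p u)" "h (p u) = m" and pv: "E (p v) v" "h (p v) = m"
      using hp[of u] hp[of v] Suc.prems sympD[OF sym, of v "p v"] by auto
    show ?case
    proof (cases "p u = p v")
      case True
      then have "E (p u) v" using pv(1) by simp
      moreover have "u \<noteq> p u" "p u \<noteq> v"
        using pu(2) Suc.prems(1,2) by (metis n_not_Suc_n)+
      ultimately show ?thesis
        using pu Suc.prems by (intro exI[of _ "[u, p u, v]"]) simp
    next
      case False
      obtain c where c: "length c \<ge> 3" "distinct c" "successively E c" "hd c = p u" "last c = p v"
          "\<forall>w\<in>set c. h w \<le> m"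
        using Suc.IH[OF pu(2) pv(2) False] by blast
      have "c \<noteq> []" using c(1) by auto
      moreover have "E u (hd c)" "E (last c) v"
        using c(4,5) pu(1) pv(1) by simp_all
      ultimately have "successively E (u # c @ [v])"
        using c(3) by (simp add: successively_append_iff successively_Cons)
      moreover have "u \<notin> set c" "v \<notin> set c"
        using c(6) Suc.prems by auto
      ultimately show ?thesis
        using c(1,2,6) Suc.prems by (intro exI[of _ "u # c @ [v]"]) (auto intro: le_SucI)
    qed
  qed
  have level: "h u \<noteq> h v" if "E u v" for u v
  proof
    assume "h u = h v"
    moreover have "u \<noteq> v" using E that by (auto simp: simple_graph_def irreflp_def)
    ultimately obtain c where c: "length c \<ge> 3" "distinct c" "successively E c" "hd c = u" "last c = v"
      using path[OF _ refl] by metis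
    have "is_cycle E c"
      using c sympD[OF sym that] by (simp add: is_cycle_def)
    then show False using acyclic by blast
  qed
  have parity: "even (h u) \<noteq> even (h v)" if "E u v" for u v
  proof -
    have "h v = Suc (h u) \<or> h u = Suc (h v)"
      using step[OF that] step[OF sympD[OF sym that]] level[OF that] by linarith
    then show ?thesis by auto
  qed
  show ?thesis
    unfolding bipartite_graph_def
    using parity by (intro exI[of _ "{v. even (h v)}"] exI[of _ "{v. odd (h v)}"]) auto
qed

section \<open>Bounding the general Randic index by discharging\<close>

text \<open>
  The general Randic index of exponent \<open>-1\<close>; the double sum meets each edge in both directions.
\<close>
definition randic_index :: "('v::finite \<Rightarrow> 'v \<Rightarrow> bool) \<Rightarrow> real" where
  "randic_index E = (\<Sum>u\<in>UNIV. \<Sum>v\<in>UNIV.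
     if E u v then 1 / (real (vertex_degree E u) * real (vertex_degree E v)) else 0) / 2"

lemma two_neighbours_degree:
  fixes E :: "'v::finite \<Rightarrow> 'v \<Rightarrow> bool"
  assumes "E u v" "E u w" "v \<noteq> w"
  shows "vertex_degree E u \<ge> 2"
proof -
  have "card {v, w} \<le> vertex_degree E u"
    unfolding vertex_degree_def using assms by (intro card_mono) auto
  then show ?thesis using assms(3) by simp
qed

text \<open>
  Here \<open>\<alpha>\<close> is the charge per vertex, \<open>F c\<close> bounds the worth of a branch whose top has degree \<open>c\<close>, and \<open>g d\<close>
  bounds what one slot of a vertex of degree \<open>d\<close> contributes. Every non-root vertex has \<open>d - 1\<close> slots, the
  remaining neighbour being its parent; the root has \<open>d\<close>. The proof adds up one local inequality per vertex,
  in which the terms \<open>F\<close> telescope. A slot taken by an edge outside the spanning tree contributes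
  half of that edge's weight; such edges avoid the root and join vertices of degree at least two,
  which is why \<open>1 / (4 d)\<close> suffices there.
\<close>
lemma randic_index_discharging:
  fixes E :: "'v::finite \<Rightarrow> 'v \<Rightarrow> bool" and F g :: "nat \<Rightarrow> real"
  assumes E: "simple_graph E" and conn: "connected_graph E"
    and root: "vertex_degree E r \<ge> 2"
    and K: "\<And>v. vertex_degree E v \<le> K"
    and slot: "\<And>c d. 1 \<le> c \<Longrightarrow> c \<le> K \<Longrightarrow> 2 \<le> d \<Longrightarrow> d \<le> K \<Longrightarrow>
                 1 / (real d * real c) + F c \<le> g d"
    and stub: "\<And>d. 2 \<le> d \<Longrightarrow> d \<le> K \<Longrightarrow> 1 / (4 * real d) \<le> g d"
    and node: "\<And>d. 1 \<le> d \<Longrightarrow> d \<le> K \<Longrightarrow> (real d - 1) * g d \<le> F d + \<alpha>"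
    and total: "real (vertex_degree E r) * g (vertex_degree E r) \<le> \<alpha> + \<beta>"
  shows "randic_index E \<le> \<alpha> * CARD('v) + \<beta>"
proof -
  have symE: "symp E"
    using E by (simp add: simple_graph_def)
  then have sym: "E u v \<longleftrightarrow> E v u" for u v
    by (metis sympD)
  obtain h :: "'v \<Rightarrow> nat" and p where hp: "\<And>v. v \<noteq> r \<Longrightarrow> E v (p v) \<and> h v = Suc (h (p v))"
      and step: "\<And>u v. E u v \<Longrightarrow> h v \<le> Suc (h u)" and h0: "h r = 0"
    by (rule bfs_tree[OF symE conn, of r]) (rule that; assumption)
  define d where "d = vertex_degree E"
  define e where "e u v = (if E u v then 1 / (real (d u) * real (d v)) else 0)" for u v
  define child where "child u w \<longleftrightarrow> w \<noteq> r \<and> p w = u" for u w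
  \<comment> \<open>What the neighbour \<open>w\<close> contributes at \<open>u\<close>: the whole edge and the worth of the branch below if \<open>w\<close> is a
     child, nothing if \<open>w\<close> is the parent, half of the edge otherwise.\<close>
  define t where "t u w = e u w / 2 + (if child u w then e u w / 2 + F (d w) else 0)
                          - (if child w u then e u w / 2 else 0)" for u w
  have e_sym: "e u w = e w u" for u w
    by (simp add: e_def sym mult.commute)
  have dpos: "d u \<ge> 1" if "E u v" for u v
  proof -
    have "card {v} \<le> d u"
      unfolding d_def vertex_degree_def using that by (intro card_mono) auto
    then show ?thesis by simp
  qed
  have childE: "E u w" "h w = Suc (h u)" if "child u w" for u w
    using hp[of w] that sym by (auto simp: child_def)
  have t_le: "t u w \<le> (if E u w \<and> \<not> child w u then g (d u) else 0)" for u w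
  proof (cases "E u w")
    case False
    then have "\<not> child u w" "\<not> child w u" using childE sym by blast+
    then show ?thesis using False by (simp add: t_def e_def)
  next
    case adj: True
    show ?thesis
    proof (cases "child w u")
      case True
      then have "\<not> child u w" using childE(2)[of u w] childE(2)[of w u] by auto
      then show ?thesis using True adj by (simp add: t_def)
    next
      case notparent: False
      have du: "d u \<ge> 2"
      proof (cases "u = r")
        case False
        then have "E u (p u)" "p u \<noteq> w" using hp[of u] notparent by (auto simp: child_def)
        then show ?thesis unfolding d_def using adj by (intro two_neighbours_degree) auto
      qed (use root in \<open>simp add: d_def\<close>)
      have dw1: "d w \<ge> 1" using adj sym dpos by blast
      show ?thesis
      proof (cases "child u w")
        case True
        have "1 / (real (d u) * real (d w)) + F (d w) \<le> g (d u)"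
          using dw1 du K by (intro slot) (auto simp: d_def)
        then show ?thesis using True notparent adj by (simp add: t_def e_def d_def)
      next
        case notchild: False
        \<comment> \<open>Every neighbour of the root is at distance one, hence has the root as its parent.\<close>
        have "w \<noteq> r"
        proof
          assume "w = r"
          then have "u \<noteq> r" using E adj by (auto simp: simple_graph_def irreflp_def)
          moreover have "h u \<le> 1" using step[of w u] adj sym h0 \<open>w = r\<close> by auto
          ultimately have "h (p u) = 0" using hp[of u] by auto
          then have "p u = r" using hp[of "p u"] by fastforce
          then show False using notparent \<open>u \<noteq> r\<close> \<open>w = r\<close> by (simp add: child_def)
        qed
        then have "E w (p w)" "p w \<noteq> u" using hp[of w] notchild by (auto simp: child_def)
        then have "d w \<ge> 2" unfolding d_def using adj sym by (intro two_neighbours_degree) auto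
        then have "1 / (real (d u) * real (d w)) / 2 \<le> 1 / (4 * real (d u))"
          using du by (simp add: field_simps)
        also have "\<dots> \<le> g (d u)" using du K by (intro stub) (auto simp: d_def)
        finally show ?thesis using notchild notparent adj by (simp add: t_def e_def d_def)
      qed
    qed
  qed
  have node_le: "(\<Sum>w\<in>UNIV. t u w) \<le> (if u = r then \<beta> else F (d u)) + \<alpha>" for u
  proof -
    have "(\<Sum>w\<in>UNIV. t u w) \<le> (\<Sum>w\<in>UNIV. if E u w \<and> \<not> child w u then g (d u) else 0)"
      by (intro sum_mono t_le)
    also have "\<dots> = real (card {w. E u w \<and> \<not> child w u}) * g (d u)"
      by (simp add: sum.If_cases)
    also have "\<dots> \<le> (if u = r then \<beta> else F (d u)) + \<alpha>"
    proof (cases "u = r")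
      case True
      then have "{w. E u w \<and> \<not> child w u} = {w. E u w}" by (auto simp: child_def)
      then show ?thesis using total True by (simp add: d_def vertex_degree_def)
    next
      case False
      then have "E u (p u)" using hp by blast
      moreover have "{w. E u w \<and> \<not> child w u} = {w. E u w} - {p u}"
        using False by (auto simp: child_def)
      ultimately have "card {w. E u w \<and> \<not> child w u} = d u - 1"
        by (simp add: d_def vertex_degree_def)
      moreover have "d u \<ge> 1" using dpos \<open>E u (p u)\<close> by blast
      ultimately show ?thesis using node[of "d u"] False K by (simp add: d_def of_nat_diff)
    qed
    finally show ?thesis .
  qed
  have "(\<Sum>u\<in>UNIV. \<Sum>w\<in>UNIV. t u w) \<le> (\<Sum>u\<in>UNIV. (if u = r then \<beta> else F (d u)) + \<alpha>)"
    by (intro sum_mono node_le)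
  also have "\<dots> = \<beta> + (\<Sum>u\<in>UNIV-{r}. F (d u)) + \<alpha> * CARD('v)"
    by (simp add: sum.distrib sum.If_cases Compl_eq_Diff_UNIV)
  finally have upper: "(\<Sum>u\<in>UNIV. \<Sum>w\<in>UNIV. t u w)
      \<le> \<beta> + (\<Sum>u\<in>UNIV-{r}. F (d u)) + \<alpha> * CARD('v)" .
  have "(\<Sum>u\<in>UNIV. \<Sum>w\<in>UNIV. if child u w then F (d w) else 0)
      = (\<Sum>w\<in>UNIV. \<Sum>u\<in>UNIV. if child u w then F (d w) else 0)"
    by (rule sum.swap)
  also have "\<dots> = (\<Sum>w\<in>UNIV. if w = r then 0 else F (d w))"
    by (intro sum.cong) (auto simp: child_def)
  also have "\<dots> = (\<Sum>w\<in>UNIV-{r}. F (d w))"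
    by (simp add: sum.If_cases Compl_eq_Diff_UNIV)
  finally have F_sum: "(\<Sum>u\<in>UNIV. \<Sum>w\<in>UNIV. if child u w then F (d w) else 0)
      = (\<Sum>w\<in>UNIV-{r}. F (d w))" .
  have swap: "(\<Sum>u\<in>UNIV. \<Sum>w\<in>UNIV. if child w u then e u w / 2 else 0)
      = (\<Sum>u\<in>UNIV. \<Sum>w\<in>UNIV. if child u w then e u w / 2 else 0)"
    by (subst sum.swap) (auto intro!: sum.cong e_sym)
  have "t u w = e u w / 2 + (if child u w then e u w / 2 else 0)
          + (if child u w then F (d w) else 0) - (if child w u then e u w / 2 else 0)" for u w
    by (simp add: t_def)
  then have "(\<Sum>u\<in>UNIV. \<Sum>w\<in>UNIV. t u w)
      = (\<Sum>u\<in>UNIV. \<Sum>w\<in>UNIV. e u w) / 2 + (\<Sum>w\<in>UNIV-{r}. F (d w))"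
    by (simp only: sum.distrib sum_subtractf F_sum swap sum_divide_distrib)
  moreover have "randic_index E = (\<Sum>u\<in>UNIV. \<Sum>w\<in>UNIV. e u w) / 2"
    unfolding randic_index_def e_def d_def ..
  ultimately show ?thesis using upper by linarith
qed

section \<open>The discharging certificate\<close>

text \<open>
  The four terms are the contributions, in a slot of a vertex of degree \<open>d\<close>, of the four best branches when
  each vertex is charged \<open>15/56 - s\<close>: the leaf, the path of two vertices, and the vertices of degree three
  and four that carry two and three pendant paths of two vertices. These have \<open>1\<close>, \<open>2\<close>, \<open>5\<close> and \<open>7\<close>
  vertices, which explains the coefficients of \<open>s\<close>, and at \<open>s = 0\<close> their worths are \<open>-15/56\<close>,
  \<open>1/2 - 30/56 = -1/28\<close>, \<open>4/3 - 75/56 = -1/168\<close> and \<open>15/8 - 105/56 = 0\<close>.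
\<close>
definition slot_cap :: "real \<Rightarrow> nat \<Rightarrow> real" where
  "slot_cap s d = max (max (1 / real d - 15/56 + s) (1 / (2 * real d) - 1/28 + 2 * s))
                      (max (1 / (3 * real d) - 1/168 + 5 * s) (1 / (4 * real d) + 7 * s))"

text \<open>
  Branches with a top of degree at least five may be worth \<open>\<delta>\<close> more than the best one with a top of degree
  four, since the edge to their parent of degree \<open>d\<close> is lighter by at least \<open>1/(4 d) - 1/(5 d) = 1/(20 d)\<close>.
\<close>
definition branch_cap :: "real \<Rightarrow> real \<Rightarrow> nat \<Rightarrow> real" where
  "branch_cap s \<delta> c =
     (if c = 1 then s - 15/56 else if c = 2 then 2 * s - 1/28 else if c = 3 then 5 * s - 1/168
      else if c = 4 then 7 * s else 7 * s + \<delta>)"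

lemma branch_fits_slot:
  assumes "1 \<le> c" "c \<le> K" "2 \<le> d" "d \<le> K" and \<delta>: "\<delta> \<le> 1 / (20 * real K)"
  shows "1 / (real d * real c) + branch_cap s \<delta> c \<le> slot_cap s d"
proof -
  consider "c = 1" | "c = 2" | "c = 3" | "c = 4" | "c \<ge> 5" using assms(1) by linarith
  then show ?thesis
  proof cases
    case 5
    have "1 / (real d * real c) \<le> 1 / (5 * real d)"
      using 5 assms(3) by (simp add: field_simps)
    moreover have "\<delta> \<le> 1 / (20 * real d)"
      using \<delta> by (rule order_trans) (use assms in \<open>simp add: field_simps\<close>)
    moreover have "1 / (5 * real d) + 1 / (20 * real d) = 1 / (4 * real d)"
      using assms(3) by (simp add: field_simps)
    ultimately show ?thesis
      using 5 by (simp add: slot_cap_def branch_cap_def)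
  qed (simp_all add: slot_cap_def branch_cap_def mult.commute)
qed

lemma randic_index_le:
  fixes E :: "'v::finite \<Rightarrow> 'v \<Rightarrow> bool"
  assumes "simple_graph E" "connected_graph E"
    and root: "vertex_degree E r \<ge> 2" and K: "\<And>v. vertex_degree E v \<le> K"
    and s: "0 \<le> s" and \<delta>: "\<delta> \<le> 1 / (20 * real K)"
    and node: "\<And>d. 2 \<le> d \<Longrightarrow> d \<le> K \<Longrightarrow>
                 (real d - 1) * slot_cap s d \<le> branch_cap s \<delta> d + (15/56 - s)"
    and total: "real (vertex_degree E r) * slot_cap s (vertex_degree E r) \<le> 15/56 - s + \<beta>"
  shows "randic_index E \<le> (15/56 - s) * CARD('v) + \<beta>"
proof (rule randic_index_discharging[where K = K and F = "branch_cap s \<delta>" and g = "slot_cap s" and r = r])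
  show "1 / (real d * real c) + branch_cap s \<delta> c \<le> slot_cap s d"
    if "1 \<le> c" "c \<le> K" "2 \<le> d" "d \<le> K" for c d
    using that \<delta> by (rule branch_fits_slot)
  show "1 / (4 * real d) \<le> slot_cap s d" for d
    using s by (simp add: slot_cap_def)
  show "(real d - 1) * slot_cap s d \<le> branch_cap s \<delta> d + (15/56 - s)"
    if "1 \<le> d" "d \<le> K" for d
  proof (cases "d = 1")
    case True
    then show ?thesis by (simp add: branch_cap_def)
  next
    case False
    then show ?thesis using that by (intro node) auto
  qed
qed (rule assms(1) assms(2) root K total)+

lemma mult_slot_cap_leI:
  assumes "x * (1 / real d - 15/56 + s) \<le> y" and "x * (1 / (2 * real d) - 1/28 + 2 * s) \<le> y"
    and "x * (1 / (3 * real d) - 1/168 + 5 * s) \<le> y" "x * (1 / (4 * real d) + 7 * s) \<le> y"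
  shows "x * slot_cap s d \<le> y"
proof -
  have "x * max (max a b) (max c e) \<le> y"
    if "x * a \<le> y" "x * b \<le> y" "x * c \<le> y" "x * e \<le> y" for a b c e
    using that by (simp add: max_def)
  with assms show ?thesis unfolding slot_cap_def by blast
qed

text \<open>
  At \<open>s = 0\<close> the recursion for the worth of branches closes for all degrees at once. For \<open>d \<ge> 4\<close>
  the pendant paths of two vertices give \<open>(d - 4) (2 d - 7) \<ge> 0\<close>, sharp at \<open>d = 4\<close>, and the branches with a
  top of degree three give \<open>(d - 6)\<^sup>2 + 20 \<ge> 0\<close>; the other two have room to spare.
\<close>
lemma node_inequality_zero:
  assumes "2 \<le> d"
  shows "(real d - 1) * slot_cap 0 d \<le> branch_cap 0 0 d + 15/56"
proof -
  consider "d = 2" | "d = 3" | "d \<ge> 4" using assms by linarith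
  then show ?thesis
  proof cases
    case 3
    define x where "x = real d"
    have x: "x \<ge> 4" using 3 by (simp add: x_def)
    have "(x - 4) * (2 * x - 7) \<ge> 0" using x by (intro mult_nonneg_nonneg) auto
    moreover have "(x - 6)\<^sup>2 \<ge> 0" by simp
    ultimately have "(x - 1) * (1 / x - 15/56) \<le> 15/56" "(x - 1) * (1 / (2 * x) - 1/28) \<le> 15/56"
      "(x - 1) * (1 / (3 * x) - 1/168) \<le> 15/56" "(x - 1) * (1 / (4 * x)) \<le> 15/56"
      using x by (auto simp: field_simps power2_eq_square)
    then show ?thesis
      using 3 by (intro mult_slot_cap_leI) (simp_all add: branch_cap_def x_def)
  qed (intro mult_slot_cap_leI; simp add: branch_cap_def)+
qed

text \<open>
  Either some vertex is a grandchild of the root of a breadth-first tree, and its parent qualifies, or all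
  other vertices are neighbours of the root.
\<close>
lemma exists_degree_ge_2:
  fixes E :: "'v::finite \<Rightarrow> 'v \<Rightarrow> bool"
  assumes E: "simple_graph E" and conn: "connected_graph E" and n: "CARD('v) \<ge> 3"
  obtains r where "vertex_degree E r \<ge> 2"
proof -
  have sym: "symp E" using E by (simp add: simple_graph_def)
  fix r :: 'v
  obtain h :: "'v \<Rightarrow> nat" and p where hp: "\<And>v. v \<noteq> r \<Longrightarrow> E v (p v) \<and> h v = Suc (h (p v))"
      and step: "\<And>u v. E u v \<Longrightarrow> h v \<le> Suc (h u)" and h0: "h r = 0"
    by (rule bfs_tree[OF sym conn, of r]) (rule that; assumption)
  show thesis
  proof (cases "\<exists>v. v \<noteq> r \<and> p v \<noteq> r")
    case True
    then obtain v where v: "v \<noteq> r" "p v \<noteq> r" by blast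
    have "h v = Suc (Suc (h (p (p v))))" using hp[OF v(1)] hp[OF v(2)] by simp
    then have "v \<noteq> p (p v)" by (metis n_not_Suc_n Suc_n_not_le_n le_SucI order_refl)
    then have "vertex_degree E (p v) \<ge> 2"
      using hp[OF v(1)] hp[OF v(2)] sympD[OF sym] by (intro two_neighbours_degree[of _ _ v "p (p v)"]) blast+
    then show thesis by (rule that)
  next
    case False
    have ex: "\<exists>v. v \<notin> S" if "card S < CARD('v)" for S :: "'v set"
      using that by (metis UNIV_eq_I less_irrefl)
    obtain v where v: "v \<notin> {r}" using ex[of "{r}"] n by auto
    obtain w where w: "w \<notin> {r, v}" using ex[of "{r, v}"] v n by auto
    have vw: "v \<noteq> r" "w \<noteq> r" "v \<noteq> w" using v w by auto
    then have "E v r" "E w r" using False hp[OF vw(1)] hp[OF vw(2)] by auto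
    then have "vertex_degree E r \<ge> 2"
      using vw(3) sympD[OF sym] by (intro two_neighbours_degree[of _ _ v w]) blast+
    then show thesis by (rule that)
  qed
qed

lemma randic_index_connected:
  fixes E :: "'v::finite \<Rightarrow> 'v \<Rightarrow> bool"
  assumes "simple_graph E" "connected_graph E" "CARD('v) \<ge> 3"
  shows "randic_index E \<le> (15 * real CARD('v) + 13) / 56"
proof -
  obtain r where r: "vertex_degree E r \<ge> 2" using exists_degree_ge_2[OF assms] .
  have "randic_index E \<le> (15/56 - 0) * CARD('v) + 13/56"
  proof (rule randic_index_le[OF assms(1,2) r, where K = "CARD('v)" and \<delta> = 0])
    show "vertex_degree E v \<le> CARD('v)" for v
      unfolding vertex_degree_def by (intro card_mono) auto
    show "real (vertex_degree E r) * slot_cap 0 (vertex_degree E r) \<le> 15/56 - 0 + 13/56"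
      using r by (intro mult_slot_cap_leI) (simp_all add: field_simps)
  qed (use node_inequality_zero in auto)
  then show ?thesis by simp
qed

text \<open>
  Let \<open>k\<close> be the maximum degree. For \<open>k \<ge> 14\<close> the root contributes at most \<open>1/4 - 15/56 = -1/56\<close> and nothing
  has to be saved. For smaller \<open>k\<close>, saving \<open>s\<close> per vertex pays if \<open>k\<close> times the slot value is at most
  \<open>1/4 + 102 s\<close>, which asks for a large \<open>s\<close> when \<open>k\<close> is small, whereas the recursion for branches only
  tolerates a small \<open>s\<close> when large degrees occur. No single \<open>s\<close> meets both demands for all \<open>k \<le> 13\<close>, but
  three values for three ranges of \<open>k\<close> do; in each range \<open>\<delta>\<close> is the largest value \<open>1 / (20 K)\<close> allowed.
\<close>
lemma randic_index_connected_large: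
  fixes E :: "'v::finite \<Rightarrow> 'v \<Rightarrow> bool"
  assumes "simple_graph E" "connected_graph E" and n: "CARD('v) \<ge> 103"
  shows "randic_index E \<le> (15 * real CARD('v) - 1) / 56"
proof -
  have "Max (range (vertex_degree E)) \<in> range (vertex_degree E)"
    by (intro Max_in) auto
  then obtain r where "vertex_degree E r = Max (range (vertex_degree E))" by force
  then have max: "vertex_degree E v \<le> vertex_degree E r" for v by simp
  define k where "k = vertex_degree E r"
  obtain r' where "vertex_degree E r' \<ge> 2"
    by (rule exists_degree_ge_2[OF assms(1,2)]) (use n in auto)
  then have k2: "k \<ge> 2" using max[of r'] by (simp add: k_def)
  have tier: ?thesis
    if "k \<le> K" "0 \<le> s" "\<delta> \<le> 1 / (20 * real K)"
      and "\<And>d. 2 \<le> d \<Longrightarrow> d \<le> K \<Longrightarrow>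
             (real d - 1) * slot_cap s d \<le> branch_cap s \<delta> d + (15/56 - s)"
      and "real k * slot_cap s k \<le> 1/4 + 102 * s" for K s \<delta>
  proof -
    have "randic_index E \<le> (15/56 - s) * CARD('v) + (103 * s - 1/56)"
    proof (rule randic_index_le[OF assms(1,2), where K = K and \<delta> = \<delta> and r = r])
      show "vertex_degree E v \<le> K" for v
        using max[of v] that(1) by (simp add: k_def)
      show "real (vertex_degree E r) * slot_cap s (vertex_degree E r)
          \<le> 15/56 - s + (103 * s - 1/56)"
        using that(5) by (simp add: k_def)
    qed (use k2 that in \<open>auto simp: k_def\<close>)
    also have "\<dots> = (15 * real CARD('v) - 1) / 56 - s * (real CARD('v) - 103)"
      by (simp add: field_simps)
    also have "\<dots> \<le> (15 * real CARD('v) - 1) / 56"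
    proof -
      have "0 \<le> s * (real CARD('v) - 103)"
        using n that(2) by (intro mult_nonneg_nonneg) auto
      then show ?thesis by linarith
    qed
    finally show ?thesis .
  qed
  consider "2 \<le> k" "k \<le> 5" | "6 \<le> k" "k \<le> 9" | "10 \<le> k" "k \<le> 13" | "14 \<le> k"
    using k2 by linarith
  then show ?thesis
  proof cases
    case 1
    then have k: "k \<in> {2,3,4,5}"
      unfolding insert_iff empty_iff by presburger
    show ?thesis
    proof (rule tier[of 5 "1/450" "1/100"])
      fix d :: nat assume "2 \<le> d" "d \<le> 5"
      then have "d \<in> {2,3,4,5}"
        unfolding insert_iff empty_iff by presburger
      then show "(real d - 1) * slot_cap (1/450) d \<le> branch_cap (1/450) (1/100) d + (15/56 - 1/450)"
        by (elim insertE emptyE) (simp_all add: slot_cap_def branch_cap_def)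
    qed (use k in \<open>elim insertE emptyE; simp add: slot_cap_def\<close>)+
  next
    case 2
    then have k: "k \<in> {6,7,8,9}"
      unfolding insert_iff empty_iff by presburger
    show ?thesis
    proof (rule tier[of 9 "1/1500" "1/180"])
      fix d :: nat assume "2 \<le> d" "d \<le> 9"
      then have "d \<in> {2,3,4,5,6,7,8,9}"
        unfolding insert_iff empty_iff by presburger
      then show "(real d - 1) * slot_cap (1/1500) d \<le> branch_cap (1/1500) (1/180) d + (15/56 - 1/1500)"
        by (elim insertE emptyE) (simp_all add: slot_cap_def branch_cap_def)
    qed (use k in \<open>elim insertE emptyE; simp add: slot_cap_def\<close>)+
  next
    case 3
    then have k: "k \<in> {10,11,12,13}"
      unfolding insert_iff empty_iff by presburger
    show ?thesis
    proof (rule tier[of 13 "1/2000" "1/260"])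
      fix d :: nat assume "2 \<le> d" "d \<le> 13"
      then have "d \<in> {2,3,4,5,6,7,8,9,10,11,12,13}"
        unfolding insert_iff empty_iff by presburger
      then show "(real d - 1) * slot_cap (1/2000) d \<le> branch_cap (1/2000) (1/260) d + (15/56 - 1/2000)"
        by (elim insertE emptyE) (simp_all add: slot_cap_def branch_cap_def)
    qed (use k in \<open>elim insertE emptyE; simp add: slot_cap_def\<close>)+
  next
    case 4
    show ?thesis
    proof (rule tier[of k 0 0])
      show "real k * slot_cap 0 k \<le> 1/4 + 102 * 0"
        using 4 by (intro mult_slot_cap_leI) (simp_all add: field_simps)
    qed (use node_inequality_zero in auto)
  qed
qed

section \<open>Randic energy\<close>

text \<open>
  With \<open>\<sigma> = 1\<close> and \<open>c = 1\<close> this is the eigenvector of square roots of degrees; with \<open>c = -1\<close> and \<open>\<sigma> = \<plusminus>1\<close> on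
  the two sides of a bipartite graph it is its signed companion.
\<close>
lemma randic_matrix_signed_eigenvector:
  fixes E :: "'v::finite \<Rightarrow> 'v \<Rightarrow> bool"
  assumes sym: "symp E" and \<sigma>: "\<And>u v. E u v \<Longrightarrow> \<sigma> v = c * \<sigma> u"
  defines "x \<equiv> \<chi> u. \<sigma> u * sqrt (vertex_degree E u)"
  shows "randic_matrix E *v x = c *\<^sub>R x"
proof -
  have "(randic_matrix E *v x) $ u = c * x $ u" for u
  proof -
    have "(randic_matrix E *v x) $ u
        = (\<Sum>v\<in>UNIV. if E u v then c * \<sigma> u / sqrt (vertex_degree E u) else 0)"
      unfolding matrix_vector_mult_def
    proof (simp, intro sum.cong refl)
      fix v
      have "vertex_degree E v > 0" if "E u v"
        using sympD[OF sym that] by (auto simp: vertex_degree_def card_gt_0_iff)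
      then show "randic_matrix E $ u $ v * x $ v
          = (if E u v then c * \<sigma> u / sqrt (vertex_degree E u) else 0)"
        by (simp add: randic_matrix_def x_def \<sigma> real_sqrt_mult)
    qed
    also have "\<dots> = c * \<sigma> u * (real (vertex_degree E u) / sqrt (vertex_degree E u))"
      by (simp add: sum.If_cases vertex_degree_def)
    also have "\<dots> = c * x $ u"
      by (simp add: x_def real_div_sqrt)
    finally show ?thesis .
  qed
  then show ?thesis by (simp add: vec_eq_iff)
qed

lemma transpose_randic_matrix:
  assumes "symp E"
  shows "transpose (randic_matrix E) = randic_matrix E"
proof -
  have "E u v \<longleftrightarrow> E v u" for u v using assms by (metis sympD)
  then show ?thesis
    by (simp add: transpose_def randic_matrix_def vec_eq_iff mult.commute)
qed

lemma connected_degree_pos: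
  fixes E :: "'v::finite \<Rightarrow> 'v \<Rightarrow> bool"
  assumes conn: "connected_graph E" and n: "CARD('v) \<ge> 2"
  shows "vertex_degree E u > 0"
proof -
  have "\<exists>v. v \<noteq> u"
  proof (rule ccontr)
    assume "\<nexists>v. v \<noteq> u"
    then have "UNIV = {u}" by auto
    then have "CARD('v) = 1" by (metis card_1_singleton_iff One_nat_def)
    then show False using n by simp
  qed
  then obtain v where "v \<noteq> u" by blast
  moreover have "E\<^sup>*\<^sup>* u v" using conn by (simp add: connected_graph_def)
  ultimately obtain w where "E u w" by (metis converse_rtranclpE)
  then show ?thesis by (auto simp: vertex_degree_def card_gt_0_iff)
qed

lemma randic_signed_eigenvalue:
  fixes E :: "'v::finite \<Rightarrow> 'v \<Rightarrow> bool"
  assumes E: "simple_graph E" and conn: "connected_graph E" and n: "CARD('v) \<ge> 2"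
    and \<sigma>: "\<And>u v. E u v \<Longrightarrow> \<sigma> v = c * \<sigma> u" "\<And>u. \<sigma> u \<noteq> 0"
  shows "\<exists>x. x \<noteq> 0 \<and> randic_matrix E *v x = c *\<^sub>R x"
proof -
  define x :: "real^'v" where "x = (\<chi> u. \<sigma> u * sqrt (vertex_degree E u))"
  have "x $ u \<noteq> 0" for u
    using \<sigma>(2)[of u] connected_degree_pos[OF conn n, of u] by (simp add: x_def)
  then have "x \<noteq> 0" by auto
  moreover have "randic_matrix E *v x = c *\<^sub>R x"
    unfolding x_def using E \<sigma>(1)
    by (intro randic_matrix_signed_eigenvector) (auto simp: simple_graph_def)
  ultimately show ?thesis by blast
qed

lemma randic_matrix_square_sum:
  "(\<Sum>u\<in>UNIV. \<Sum>v\<in>UNIV. (randic_matrix E $ u $ v)\<^sup>2) = 2 * randic_index E"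
proof -
  have sq: "(1 / sqrt y)\<^sup>2 = 1 / y" if "0 \<le> y" for y
    using that by (simp add: power_divide)
  have "(randic_matrix E $ u $ v)\<^sup>2
      = (if E u v then 1 / (real (vertex_degree E u) * real (vertex_degree E v)) else 0)" for u v
    using sq[of "real (vertex_degree E u) * real (vertex_degree E v)"] by (simp add: randic_matrix_def)
  then show ?thesis by (simp add: randic_index_def)
qed

lemma randic_energy_connected:
  fixes E :: "'v::finite \<Rightarrow> 'v \<Rightarrow> bool"
  assumes E: "simple_graph E" and conn: "connected_graph E" and n: "CARD('v) \<ge> 2"
    and X: "2 * randic_index E - 1 \<le> X"
  shows "randic_energy E
       \<le> sqrt ((real CARD('v) - 1 - nullity (randic_matrix E)) * X) + 1"
proof -
  have sym: "transpose (randic_matrix E) = randic_matrix E"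
    using E by (simp add: simple_graph_def transpose_randic_matrix)
  have ev: "\<exists>x. x \<noteq> 0 \<and> randic_matrix E *v x = c *\<^sub>R x" if "c \<in> {1}" for c
    using that randic_signed_eigenvalue[OF E conn n, of "\<lambda>_. 1" c] by auto
  have "{1} \<subseteq> {1, - 1 :: real}" and card1: "real (card {1 :: real}) = 1" by simp_all
  note bound = energy_bound_unit_eigenvalues[OF sym this(1) ev, unfolded randic_matrix_square_sum card1]
  have "real CARD('v) - 1 - nullity (randic_matrix E) \<ge> 0"
    using bound(1) by simp
  then have "sqrt ((real CARD('v) - 1 - nullity (randic_matrix E))
          * (2 * randic_index E - 1))
      \<le> sqrt ((real CARD('v) - 1 - nullity (randic_matrix E)) * X)"
    using X by (intro real_sqrt_le_mono mult_left_mono)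
  then show ?thesis
    unfolding randic_energy_def using bound(2) by linarith
qed

text \<open>
  With two vertices the first factor under the root vanishes, so \<open>X\<close> is not constrained then. With one vertex
  the energy is zero and both factors are nonpositive, which keeps the square root nonnegative.
\<close>
lemma randic_energy_bipartite:
  fixes E :: "'v::finite \<Rightarrow> 'v \<Rightarrow> bool"
  assumes E: "simple_graph E" and conn: "connected_graph E" and bip: "bipartite_graph E"
    and X: "CARD('v) \<ge> 3 \<Longrightarrow> 2 * randic_index E - 2 \<le> X"
    and X1: "CARD('v) = 1 \<Longrightarrow> X \<le> 0"
  shows "randic_energy E
       \<le> sqrt ((real CARD('v) - 2 - nullity (randic_matrix E)) * X) + 2"
proof -
  have sym: "transpose (randic_matrix E) = randic_matrix E"
    using E by (simp add: simple_graph_def transpose_randic_matrix)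
  show ?thesis
  proof (cases "CARD('v) = 1")
    case True
    then obtain a :: 'v where a: "UNIV = {a}" by (metis card_1_singletonE)
    have "\<not> E u v" for u v
    proof -
      have "u = a" "v = a" using a by auto
      then show ?thesis using E by (simp add: simple_graph_def irreflp_def)
    qed
    then have "randic_energy E \<le> 0"
      using energy_bound_unit_eigenvalues(2)[OF sym, of "{}"]
      by (simp add: randic_energy_def randic_matrix_square_sum randic_index_def)
    moreover have "0 \<le> (real CARD('v) - 2 - nullity (randic_matrix E)) * X"
      using X1[OF True] True by (intro mult_nonpos_nonpos) auto
    then have "0 \<le> sqrt ((real CARD('v) - 2 - nullity (randic_matrix E)) * X)"
      by simp
    ultimately show ?thesis by linarith
  next
    case False
    moreover have "CARD('v) > 0" by simp
    ultimately have n: "CARD('v) \<ge> 2" by linarith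
    obtain A B where AB: "A \<inter> B = {}"
        "\<And>u v. E u v \<Longrightarrow> (u \<in> A \<and> v \<in> B) \<or> (u \<in> B \<and> v \<in> A)"
      using bip unfolding bipartite_graph_def by blast
    have ev: "\<exists>x. x \<noteq> 0 \<and> randic_matrix E *v x = c *\<^sub>R x" if "c \<in> {1, -1}" for c
    proof (cases "c = 1")
      case True
      then show ?thesis
        using randic_signed_eigenvalue[OF E conn n, of "\<lambda>_. 1" c] by auto
    next
      case False
      then have c: "c = -1" using that by simp
      show ?thesis
      proof (rule randic_signed_eigenvalue[OF E conn n])
        show "(if v \<in> A then 1 else - 1) = c * (if u \<in> A then 1 else - 1)" if "E u v" for u v
          using AB(1) AB(2)[OF that] c by auto
      qed simp
    qed
    have card2: "real (card {1, - 1 :: real}) = 2" by simp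
    note bound = energy_bound_unit_eigenvalues[OF sym order_refl ev,
        unfolded randic_matrix_square_sum card2]
    have nonneg: "real CARD('v) - 2 - nullity (randic_matrix E) \<ge> 0"
      using bound(1) by simp
    have "(real CARD('v) - 2 - nullity (randic_matrix E))
            * (2 * randic_index E - 2)
        \<le> (real CARD('v) - 2 - nullity (randic_matrix E)) * X"
    proof (cases "CARD('v) = 2")
      case True
      then show ?thesis using nonneg by simp
    next
      case False
      then show ?thesis using n by (intro mult_left_mono X nonneg) linarith
    qed
    from real_sqrt_le_mono[OF this] show ?thesis
      unfolding randic_energy_def using bound(2) by linarith
  qed
qed

theorem corollary4p2:
  fixes E :: "'v::finite \<Rightarrow> 'v \<Rightarrow> bool" and n :: nat and R :: "real^'v^'v"
  assumes "simple_graph E"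
    and "n = CARD('v)"
    and "R = randic_matrix E"
  shows
    "(connected_graph E \<and> n \<ge> 3 \<longrightarrow>
       randic_energy E
         \<le> sqrt ((real n - 1 - real (nullity R)) * ((15 * real n - 13) / 28)) + 1) \<and>
     (connected_graph E \<and> bipartite_graph E \<longrightarrow>
       randic_energy E
         \<le> sqrt ((real n - 2 - real (nullity R)) * ((15 * real n - 41) / 28)) + 2) \<and>
     (tree_graph E \<longrightarrow>
       randic_energy E
         \<le> sqrt ((real n - 2 - real (nullity R)) * ((5 * real n - 10) / 9)) + 2) \<and>
     (tree_graph E \<and> n \<ge> 103 \<longrightarrow>
       randic_energy E
         \<le> sqrt ((real n - 2 - real (nullity R)) * ((15 * real n - 57) / 28)) + 2)"
proof -
  note E = assms(1)
  have W: "randic_index E \<le> (15 * real n + 13) / 56" if "connected_graph E" "n \<ge> 3"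
    using randic_index_connected[OF E that(1)] that(2) by (simp add: assms(2))
  have W_large: "randic_index E \<le> (15 * real n - 1) / 56" if "connected_graph E" "n \<ge> 103"
    using randic_index_connected_large[OF E that(1)] that(2) by (simp add: assms(2))
  have tree: "connected_graph E" "bipartite_graph E" if "tree_graph E"
    using that tree_is_bipartite[OF E] by (auto simp: tree_graph_def)
  show ?thesis
  proof (intro conjI impI; (elim conjE)?)
    assume G: "connected_graph E" "n \<ge> 3"
    have "2 * randic_index E - 1 \<le> (15 * real n - 13) / 28"
      using W[OF G] by (simp add: field_simps)
    from randic_energy_connected[OF E G(1) _ this] G(2) show "randic_energy E
        \<le> sqrt ((real n - 1 - real (nullity R)) * ((15 * real n - 13) / 28)) + 1"
      unfolding assms(2,3) by linarith
  next
    assume G: "connected_graph E" "bipartite_graph E"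
    have "2 * randic_index E - 2 \<le> (15 * real n - 41) / 28" if "n \<ge> 3"
      using W[OF G(1) that] by (simp add: field_simps)
    with assms(2) show "randic_energy E
        \<le> sqrt ((real n - 2 - real (nullity R)) * ((15 * real n - 41) / 28)) + 2"
      unfolding assms(2,3) by (intro randic_energy_bipartite[OF E G]) (blast, simp)
  next
    assume T: "tree_graph E"
    have "2 * randic_index E - 2 \<le> (5 * real n - 10) / 9" if "n \<ge> 3"
      using W[OF tree(1)[OF T] that] that by (simp add: field_simps)
    with assms(2) show "randic_energy E
        \<le> sqrt ((real n - 2 - real (nullity R)) * ((5 * real n - 10) / 9)) + 2"
      unfolding assms(2,3) by (intro randic_energy_bipartite[OF E tree[OF T]]) (blast, simp)
  next
    assume T: "tree_graph E" "n \<ge> 103"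
    have "2 * randic_index E - 2 \<le> (15 * real n - 57) / 28"
      using W_large[OF tree(1)[OF T(1)] T(2)] by (simp add: field_simps)
    from this T(2) show "randic_energy E
        \<le> sqrt ((real n - 2 - real (nullity R)) * ((15 * real n - 57) / 28)) + 2"
      unfolding assms(2,3) by (intro randic_energy_bipartite[OF E tree[OF T(1)]]) simp_all
  qed
qed

end
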